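(* Let $p$ be a prime, let $K$ be a perfectoid field with residue characteristic $p$, let $n$ be a positive integer, and let $X=\mathbb{P}_K^{n,\mathrm{ad,perf}}$ be the projective perfectoid space of dimension $n$ over $K$, with structure sheaf $\mathcal{O}_X$. Then $H^i(X,\mathcal{O}_X)=0$ for every integer $i$ with $0<i<n$.
   Context: $\mathbb{Z}[1/p]$ is the set of rationals $a/p^b$ with $a\in\mathbb{Z}$, $b\in\mathbb{Z}_{\ge 0}$. The ring $K\langle T_1^{1/p^\infty},\dots,T_n^{1/p^\infty}\rangle$ consists of the series $\sum_{\alpha} a_\alpha T^\alpha$ indexed by $\alpha\in(\mathbb{Z}[1/p]_{\ge 0})^n$ with $a_\alpha\in K$ and $|a_\alpha|\to 0$ (for each $\varepsilon>0$ only finitely many $\alpha$ have $|a_\alpha|>\varepsilon$); it is the completion of $K[T_1^{1/p^\infty},\dots,T_n^{1/p^\infty}]$ for the Gauss norm. The projective perfectoid space $\mathbb{P}_K^{n,\mathrm{ad,perf}}$ (Scholze), with homogeneous coordinates $X_0,\dots,X_n$ and all their $p$-power roots, is the adic space over $K$ obtained by gluing the $n+1$ affinoid perfectoid spaces $U_i=D(X_i)$, $0\le i\le n$, where $\mathcal{O}(U_i)=K\langle (X_j/X_i)^{1/p^\infty} : j\ne i\rangle$, along the open subsets $U_i\cap U_j=\{|X_j/X_i|=1\}$ of $U_i$, in the usual way: monomials $\prod_k X_k^{\alpha_k}$ with $\alpha_k\in\mathbb{Z}[1/p]$ and $\sum_k\alpha_k=0$ are identified. Cohomology is sheaf cohomology,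 and is computed by the Čech complex of the cover $\{U_i\}_{0\le i\le n}$. *)

theory Defs
  imports
    "HOL-Computational_Algebra.Primes"
    "HOL-Analysis.Abstract_Metric_Spaces"
    "HOL-Algebra.Elementary_Groups"
begin

section \<open>Perfectoid fields\<close>

text \<open>
  A perfectoid field: a field, complete for a non-discrete valuation of rank one \<open>v\<close> (written
  multiplicatively), whose residue field has characteristic \<open>p\<close> (a natural number \<open>m\<close> vanishes
  in the residue field exactly if \<open>v m < 1\<close>), and such that Frobenius is surjective
  on \<open>\<O> / p\<O>\<close>, where \<open>\<O>\<close> is the valuation ring.  The field may have characteristic \<open>0\<close> or \<open>p\<close>.
\<close>

locale perfectoid_field =
  fixes p :: nat and v :: "'k::field \<Rightarrow> real"
  assumes prime_p: "prime p"
    and v_nonneg: "0 \<le> v x"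
    and v_eq_0: "v x = 0 \<longleftrightarrow> x = 0"
    and v_mult: "v (x * y) = v x * v y"
    and v_add: "v (x + y) \<le> max (v x) (v y)"
    and nondiscrete: "r < 1 \<Longrightarrow> \<exists>x. r < v x \<and> v x < 1"
    and complete: "Metric_space.mcomplete UNIV (\<lambda>x y. v (x - y))"
    and residue_char: "v (of_nat m) < 1 \<longleftrightarrow> p dvd m"
    and frobenius_surj:
      "v x \<le> 1 \<Longrightarrow> \<exists>y z. v y \<le> 1 \<and> v z \<le> 1 \<and> x = y ^ p + of_nat p * z"

section \<open>Series in monomials with exponents in \<open>\<int>[1/p]\<close>\<close>

definition Z_inv :: "nat \<Rightarrow> rat set" where
  "Z_inv p = {of_int a / of_nat p ^ b | (a::int) (b::nat). True}"

text \<open>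
  A series \<open>\<Sum>\<alpha>. a \<alpha> X^\<alpha>\<close> is its coefficient function; an exponent vector
  \<open>\<alpha>\<close> assigns to \<open>k \<le> n\<close> the exponent of the homogeneous coordinate \<open>X k\<close> and vanishes
  for \<open>k > n\<close>.
\<close>

type_synonym exponent = "nat \<Rightarrow> rat"
type_synonym 'k series = "exponent \<Rightarrow> 'k"

definition degree0 :: "nat \<Rightarrow> nat \<Rightarrow> exponent set" where
  "degree0 p n = {\<alpha>. (\<forall>k. \<alpha> k \<in> Z_inv p) \<and> (\<forall>k>n. \<alpha> k = 0) \<and> (\<Sum>k\<le>n. \<alpha> k) = 0}"

definition series_on :: "('k::field \<Rightarrow> real) \<Rightarrow> exponent set \<Rightarrow> 'k series set" where
  "series_on v M =
     {a. (\<forall>\<epsilon>>0. finite {\<alpha>. v (a \<alpha>) > \<epsilon>}) \<and> (\<forall>\<alpha>. \<alpha> \<notin> M \<longrightarrow> a \<alpha> = 0)}"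

definition gauss_norm :: "('k::field \<Rightarrow> real) \<Rightarrow> 'k series \<Rightarrow> real" where
  "gauss_norm v a = (SUP \<alpha>. v (a \<alpha>))"

text \<open>Multiplication by the monomial \<open>X^\<beta>\<close>.\<close>

definition monomial_mult :: "exponent \<Rightarrow> 'k series \<Rightarrow> 'k series" where
  "monomial_mult \<beta> a = (\<lambda>\<alpha>. a (\<lambda>k. \<alpha> k - \<beta> k))"

section \<open>The structure sheaf of projective perfectoid space on the standard cover\<close>

text \<open>
  \<open>\<O>(U i) = K\<langle>(X j / X i)^(1/p^\<infinity>) : j \<noteq> i\<rangle>\<close>: a monomial in the \<open>X j / X i\<close> with exponents
  \<open>\<alpha> j \<ge> 0\<close> for \<open>j \<noteq> i\<close> is the homogeneous monomial of degree \<open>0\<close> with the same exponents at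
  \<open>j \<noteq> i\<close>, and \<open>\<alpha> i\<close> determined by the degree.
\<close>

definition chart_exponents :: "nat \<Rightarrow> nat \<Rightarrow> nat \<Rightarrow> exponent set" where
  "chart_exponents p n i = {\<alpha> \<in> degree0 p n. \<forall>k. k \<noteq> i \<longrightarrow> 0 \<le> \<alpha> k}"

definition chart_ring :: "nat \<Rightarrow> ('k::field \<Rightarrow> real) \<Rightarrow> nat \<Rightarrow> nat \<Rightarrow> 'k series set" where
  "chart_ring p v n i = series_on v (chart_exponents p n i)"

text \<open>
  Let \<open>i \<in> I\<close>.  The intersection of the \<open>U j\<close>, \<open>j \<in> I\<close>, is the rational subset
  \<open>{\<bar>X j / X i\<bar> = 1 for j \<in> I}\<close> of \<open>U i\<close>, i.e. \<open>{\<bar>f\<bar> = 1}\<close> for the product \<open>f\<close> of the \<open>X j / X i\<close>,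
  \<open>j \<in> I\<close>.  Its ring of sections is the completion of the localization \<open>\<O>(U i)[1/f]\<close>, topologized
  so that the image of \<open>\<O>(U i)\<degree>[1/f]\<close> is open and bounded.
  Here \<open>\<O>(U i)\<degree>\<close> is the unit ball of the Gauss norm and \<open>f\<close> is a monomial, so this is the Gauss
  norm topology.  The completion is taken inside the ring of all degree \<open>0\<close> series, which is
  complete for the Gauss norm.
\<close>

definition chart_monomial :: "nat \<Rightarrow> nat set \<Rightarrow> nat \<Rightarrow> exponent" where
  "chart_monomial i I m =
     (\<lambda>k. of_nat m * ((if k \<in> I then 1 else 0) - (if k = i then of_nat (card I) else 0)))"

definition localized_ring ::
  "nat \<Rightarrow> ('k::field \<Rightarrow> real) \<Rightarrow> nat \<Rightarrow> nat \<Rightarrow> nat set \<Rightarrow> 'k series set" where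
  "localized_ring p v n i I =
     {a. \<exists>m. monomial_mult (chart_monomial i I m) a \<in> chart_ring p v n i}"

definition chart_sections ::
  "nat \<Rightarrow> ('k::field \<Rightarrow> real) \<Rightarrow> nat \<Rightarrow> nat \<Rightarrow> nat set \<Rightarrow> 'k series set" where
  "chart_sections p v n i I =
     {b \<in> series_on v (degree0 p n).
        \<forall>\<epsilon>>0. \<exists>a \<in> localized_ring p v n i I. gauss_norm v (\<lambda>\<alpha>. b \<alpha> - a \<alpha>) < \<epsilon>}"

text \<open>
  Gluing identifies equal monomials, so the sections over the intersection do not depend
  on the chart (lemma \<open>chart_sections_eq\<close> below), and restriction maps are inclusions
  (lemma \<open>proj_sections_mono\<close>).
\<close>

definition proj_sections ::
  "nat \<Rightarrow> ('k::field \<Rightarrow> real) \<Rightarrow> nat \<Rightarrow> nat set \<Rightarrow> 'k series set" where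
  "proj_sections p v n I = chart_sections p v n (Min I) I"

section \<open>Cohomology of the structure sheaf\<close>

text \<open>
  The Cech complex of ordered cochains of the cover \<open>U 0, \<dots>, U n\<close>: an increasing tuple of
  indices is represented by its set \<open>I\<close>.  Cochains are set to \<open>0\<close> outside their index set, to make
  them determined by their components.
\<close>

definition cech_index :: "nat \<Rightarrow> nat \<Rightarrow> nat set set" where
  "cech_index n q = {I. I \<subseteq> {..n} \<and> card I = Suc q}"

definition cech_group ::
  "nat \<Rightarrow> ('k::field \<Rightarrow> real) \<Rightarrow> nat \<Rightarrow> nat \<Rightarrow> (nat set \<Rightarrow> 'k series) monoid" where
  "cech_group p v n q =
     \<lparr>carrier = {c. \<forall>I. if I \<in> cech_index n q then c I \<in> proj_sections p v n I
                        else c I = (\<lambda>\<alpha>. 0)},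
      mult = (\<lambda>c d I \<alpha>. c I \<alpha> + d I \<alpha>),
      one = (\<lambda>I \<alpha>. 0)\<rparr>"

text \<open>The element \<open>j\<close> of \<open>J\<close> has position \<open>card {k \<in> J. k < j}\<close>, counted from \<open>0\<close>.\<close>

definition cech_diff ::
  "nat \<Rightarrow> nat \<Rightarrow> (nat set \<Rightarrow> 'k::field series) \<Rightarrow> nat set \<Rightarrow> 'k series" where
  "cech_diff n q c = (\<lambda>J \<alpha>.
     if J \<in> cech_index n (Suc q)
     then (\<Sum>j\<in>J. (- 1) ^ card {k \<in> J. k < j} * c (J - {j}) \<alpha>) else 0)"

definition cech_cocycles ::
  "nat \<Rightarrow> ('k::field \<Rightarrow> real) \<Rightarrow> nat \<Rightarrow> nat \<Rightarrow> (nat set \<Rightarrow> 'k series) set" where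
  "cech_cocycles p v n q =
     kernel (cech_group p v n q) (cech_group p v n (Suc q)) (cech_diff n q)"

fun cech_coboundaries ::
  "nat \<Rightarrow> ('k::field \<Rightarrow> real) \<Rightarrow> nat \<Rightarrow> nat \<Rightarrow> (nat set \<Rightarrow> 'k series) set" where
  "cech_coboundaries p v n 0 = {\<one>\<^bsub>cech_group p v n 0\<^esub>}"
| "cech_coboundaries p v n (Suc q) = cech_diff n q ` carrier (cech_group p v n q)"

text \<open>
  \<open>H^q(X, \<O>_X)\<close> for \<open>X\<close> the projective perfectoid space of dimension \<open>n\<close>, computed by the
  Cech complex of the cover by the affinoid perfectoid spaces \<open>U i\<close>.
\<close>

definition proj_cohomology ::
  "nat \<Rightarrow> ('k::field \<Rightarrow> real) \<Rightarrow> nat \<Rightarrow> nat \<Rightarrow> (nat set \<Rightarrow> 'k series) set monoid" where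
  "proj_cohomology p v n q =
     (cech_group p v n q)\<lparr>carrier := cech_cocycles p v n q\<rparr> Mod cech_coboundaries p v n q"

section \<open>Explicit description of the sections\<close>

context perfectoid_field
begin

lemma v_0 [simp]: "v 0 = 0"
  by (simp add: v_eq_0)

lemma v_minus: "v (- x) = v x"
proof -
  have "v (-1) * v (-1) = v 1" "v 1 * v 1 = v 1" "v 1 \<noteq> 0"
    using v_mult[of "-1" "-1"] v_mult[of 1 1] by (auto simp: v_eq_0)
  then have "(v (-1))\<^sup>2 = 1"
    by (simp add: power2_eq_square)
  then have "v (-1) = 1"
    using v_nonneg[of "-1"] by (simp add: power2_eq_1_iff)
  then show ?thesis
    using v_mult[of "-1" x] by simp
qed

lemma v_diff: "v (x - y) \<le> max (v x) (v y)"
  using v_add[of x "- y"] by (simp add: v_minus)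

lemma series_bdd_above:
  assumes "a \<in> series_on v M"
  shows "bdd_above (range (\<lambda>\<alpha>. v (a \<alpha>)))"
proof -
  let ?F = "{\<alpha>. v (a \<alpha>) > 1}"
  have "range (\<lambda>\<alpha>. v (a \<alpha>)) \<subseteq> (\<lambda>\<alpha>. v (a \<alpha>)) ` ?F \<union> {..1}"
    by force
  moreover have "finite ?F"
    using assms by (auto simp: series_on_def)
  ultimately show ?thesis
    by (meson bdd_above_Iic bdd_above_Un bdd_above_finite bdd_above_mono finite_imageI)
qed

lemma series_diff:
  assumes "a \<in> series_on v M" "b \<in> series_on v M'"
  shows "(\<lambda>\<alpha>. a \<alpha> - b \<alpha>) \<in> series_on v (M \<union> M')"
proof -
  have "finite {\<alpha>. v (a \<alpha> - b \<alpha>) > \<epsilon>}" if "\<epsilon> > 0" for \<epsilon>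
  proof (rule finite_subset)
    show "{\<alpha>. v (a \<alpha> - b \<alpha>) > \<epsilon>} \<subseteq> {\<alpha>. v (a \<alpha>) > \<epsilon>} \<union> {\<alpha>. v (b \<alpha>) > \<epsilon>}"
      using v_diff by (fastforce simp: max_def split: if_splits intro: order.strict_trans2)
    show "finite ({\<alpha>. v (a \<alpha>) > \<epsilon>} \<union> {\<alpha>. v (b \<alpha>) > \<epsilon>})"
      using assms that by (auto simp: series_on_def)
  qed
  then show ?thesis
    using assms by (auto simp: series_on_def)
qed

lemma series_shift:
  assumes "monomial_mult \<beta> a \<in> series_on v M"
  shows "a \<in> series_on v UNIV"
proof -
  let ?s = "\<lambda>\<alpha> k. \<alpha> k + \<beta> k"
  have *: "monomial_mult \<beta> a (?s \<alpha>) = a \<alpha>" for \<alpha>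
    by (simp add: monomial_mult_def)
  have inj: "inj ?s"
    by (auto simp: inj_def fun_eq_iff)
  have "finite {\<alpha>. v (a \<alpha>) > \<epsilon>}" if "\<epsilon> > 0" for \<epsilon>
  proof -
    have "finite (?s -` {\<alpha>. v (monomial_mult \<beta> a \<alpha>) > \<epsilon>})"
      using assms that inj by (intro finite_vimageI) (auto simp: series_on_def)
    then show ?thesis
      by (simp add: vimage_def *)
  qed
  then show ?thesis
    by (auto simp: series_on_def)
qed

end

lemma of_int_in_Z_inv: "of_int z \<in> Z_inv p"
  unfolding Z_inv_def by (rule CollectI, rule exI[of _ z], rule exI[of _ 0]) simp

lemma Z_inv_add:
  assumes "x \<in> Z_inv p" "y \<in> Z_inv p" "p > 0"
  shows "x + y \<in> Z_inv p"
proof -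
  obtain a b c d where xy: "x = of_int a / of_nat p ^ b" "y = of_int c / of_nat p ^ d"
    using assms by (auto simp: Z_inv_def)
  have "x + y = of_int (a * int p ^ d + c * int p ^ b) / of_nat p ^ (b + d)"
    unfolding xy using assms(3) by (simp add: add_frac_eq power_add)
  then show ?thesis
    unfolding Z_inv_def by blast
qed

lemma degree0_shift:
  assumes "\<alpha> \<in> degree0 p n" "i \<in> I" "I \<subseteq> {..n}" "p > 0"
  shows "(\<lambda>k. \<alpha> k + chart_monomial i I m k) \<in> degree0 p n"
proof -
  have "(\<Sum>k\<le>n. (if k \<in> I then 1 else 0) - (if k = i then of_nat (card I) else 0) :: rat) = 0"
    using assms by (auto simp: sum_subtractf sum.If_cases Int_absorb1 Int_absorb2)
  then have "(\<Sum>k\<le>n. chart_monomial i I m k) = 0"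
    unfolding chart_monomial_def sum_distrib_left[symmetric] by simp
  moreover have "chart_monomial i I m k \<in> Z_inv p" for k
  proof -
    have "chart_monomial i I m k =
      of_int (int m * ((if k \<in> I then 1 else 0) - (if k = i then int (card I) else 0)))"
      by (simp add: chart_monomial_def)
    then show ?thesis
      by (simp only: of_int_in_Z_inv)
  qed
  moreover have "chart_monomial i I m k = 0" if "k > n" for k
    using assms that by (auto simp: chart_monomial_def)
  ultimately show ?thesis
    using assms by (auto simp: degree0_def sum.distrib intro: Z_inv_add)
qed

lemma (in perfectoid_field) chart_sections_eq:
  assumes "i \<in> I" "I \<subseteq> {..n}"
  shows "chart_sections p v n i I =
    series_on v {\<alpha> \<in> degree0 p n. \<forall>k. k \<notin> I \<longrightarrow> 0 \<le> \<alpha> k}" (is "_ = series_on v ?M")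
proof (intro equalityI subsetI)
  fix b assume b: "b \<in> chart_sections p v n i I"
  have "\<alpha> \<in> ?M" if nz: "b \<alpha> \<noteq> 0" for \<alpha>
  proof -
    have deg: "\<alpha> \<in> degree0 p n"
      using b nz by (auto simp: chart_sections_def series_on_def)
    have "v (b \<alpha>) > 0"
      using nz v_nonneg[of "b \<alpha>"] v_eq_0[of "b \<alpha>"] by linarith
    then obtain a where a: "a \<in> localized_ring p v n i I"
      and less: "gauss_norm v (\<lambda>\<alpha>. b \<alpha> - a \<alpha>) < v (b \<alpha>)"
      using b by (auto simp: chart_sections_def)
    obtain m where m: "monomial_mult (chart_monomial i I m) a \<in> chart_ring p v n i"
      using a by (auto simp: localized_ring_def)
    have "(\<lambda>\<alpha>. b \<alpha> - a \<alpha>) \<in> series_on v (degree0 p n \<union> UNIV)"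
      using b m by (intro series_diff) (auto simp: chart_sections_def chart_ring_def intro: series_shift)
    then have "v (b \<alpha> - a \<alpha>) \<le> gauss_norm v (\<lambda>\<alpha>. b \<alpha> - a \<alpha>)"
      unfolding gauss_norm_def by (intro cSUP_upper series_bdd_above) auto
    then have "a \<alpha> \<noteq> 0"
      using less by auto
    then have "(\<lambda>k. \<alpha> k + chart_monomial i I m k) \<in> chart_exponents p n i"
      using m by (force simp: chart_ring_def series_on_def monomial_mult_def)
    then have "0 \<le> \<alpha> k + chart_monomial i I m k" if "k \<noteq> i" for k
      using that by (auto simp: chart_exponents_def)
    moreover have "k \<noteq> i \<and> chart_monomial i I m k = 0" if "k \<notin> I" for k
      using that assms by (auto simp: chart_monomial_def)
    ultimately have "0 \<le> \<alpha> k" if "k \<notin> I" for k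
      using that by (metis add.right_neutral)
    then show ?thesis
      using deg by auto
  qed
  then show "b \<in> series_on v ?M"
    using b by (auto simp: chart_sections_def series_on_def)
next
  fix b assume b: "b \<in> series_on v ?M"
  have "\<exists>a \<in> localized_ring p v n i I. gauss_norm v (\<lambda>\<alpha>. b \<alpha> - a \<alpha>) < \<epsilon>" if \<epsilon>: "\<epsilon> > 0" for \<epsilon>
  proof -
    define F where "F = {\<alpha>. v (b \<alpha>) > \<epsilon> / 2}"
    define a where "a = (\<lambda>\<alpha>. if \<alpha> \<in> F then b \<alpha> else 0)"
    have fin: "finite F"
      using b half_gt_zero[OF \<epsilon>] unfolding F_def series_on_def by blast
    have FM: "F \<subseteq> ?M"
    proof
      fix \<alpha> assume "\<alpha> \<in> F"
      then have "b \<alpha> \<noteq> 0"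
        using \<epsilon> by (auto simp: F_def)
      then show "\<alpha> \<in> ?M"
        using b unfolding series_on_def by blast
    qed
    have "finite I"
      using assms finite_subset by blast
    then have "finite ((\<lambda>(\<alpha>, k). - \<alpha> k) ` (F \<times> I))"
      using fin by blast
    then have "bdd_above ((\<lambda>(\<alpha>, k). - \<alpha> k) ` (F \<times> I))"
      by (rule bdd_above_finite)
    then obtain B where "\<forall>x \<in> (\<lambda>(\<alpha>, k). - \<alpha> k) ` (F \<times> I). x \<le> B"
      unfolding bdd_above_def by blast
    then have B: "- \<alpha> k \<le> B" if "\<alpha> \<in> F" "k \<in> I" for \<alpha> k
      using that by force
    obtain m :: nat where m: "B \<le> of_nat m"
      using reals_Archimedean2[of B] less_imp_le by blast
    have "monomial_mult (chart_monomial i I m) a \<in> chart_ring p v n i"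
    proof -
      let ?s = "\<lambda>\<alpha> k. \<alpha> k + chart_monomial i I m k"
      have supp: "\<gamma> \<in> ?s ` F" if "monomial_mult (chart_monomial i I m) a \<gamma> \<noteq> 0" for \<gamma>
        using that by (intro image_eqI[of _ _ "\<lambda>k. \<gamma> k - chart_monomial i I m k"])
          (auto simp: monomial_mult_def a_def split: if_splits)
      have "?s \<alpha> \<in> chart_exponents p n i" if "\<alpha> \<in> F" for \<alpha>
      proof -
        have "?s \<alpha> \<in> degree0 p n"
          using that FM assms prime_p by (intro degree0_shift) (auto simp: prime_gt_0_nat)
        moreover have "0 \<le> ?s \<alpha> k" if "k \<noteq> i" for k
        proof (cases "k \<in> I")
          case True
          then show ?thesis
            using B[OF \<open>\<alpha> \<in> F\<close> True] m that by (simp add: chart_monomial_def)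
        next
          case False
          then show ?thesis
            using FM \<open>\<alpha> \<in> F\<close> that by (auto simp: chart_monomial_def)
        qed
        ultimately show ?thesis
          by (simp add: chart_exponents_def)
      qed
      moreover have "finite {\<gamma>. v (monomial_mult (chart_monomial i I m) a \<gamma>) > \<delta>}" if "\<delta> > 0" for \<delta>
        using that supp by (intro finite_subset[OF _ finite_imageI[OF fin, of ?s]]) force
      ultimately show ?thesis
        using supp unfolding chart_ring_def series_on_def by blast
    qed
    moreover have "gauss_norm v (\<lambda>\<alpha>. b \<alpha> - a \<alpha>) \<le> \<epsilon> / 2"
      unfolding gauss_norm_def using \<epsilon> by (intro cSUP_least) (auto simp: a_def F_def)
    ultimately show ?thesis
      using \<epsilon> by (intro bexI[of _ a]) (auto simp: localized_ring_def)
  qed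
  then show "b \<in> chart_sections p v n i I"
    using b by (auto simp: chart_sections_def series_on_def)
qed

lemma (in perfectoid_field) proj_sections_eq:
  assumes "I \<noteq> {}" "I \<subseteq> {..n}"
  shows "proj_sections p v n I =
    series_on v {\<alpha> \<in> degree0 p n. \<forall>k. k \<notin> I \<longrightarrow> 0 \<le> \<alpha> k}"
proof -
  have "finite I"
    using assms finite_subset by blast
  then show ?thesis
    unfolding proj_sections_def using assms by (intro chart_sections_eq) auto
qed

lemma (in perfectoid_field) proj_sections_mono:
  assumes "I \<noteq> {}" "I \<subseteq> J" "J \<subseteq> {..n}"
  shows "proj_sections p v n I \<subseteq> proj_sections p v n J"
proof -
  have "proj_sections p v n I = series_on v {\<alpha> \<in> degree0 p n. \<forall>k. k \<notin> I \<longrightarrow> 0 \<le> \<alpha> k}"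
    "proj_sections p v n J = series_on v {\<alpha> \<in> degree0 p n. \<forall>k. k \<notin> J \<longrightarrow> 0 \<le> \<alpha> k}"
    using assms by (intro proj_sections_eq; auto)+
  moreover have "{\<alpha> \<in> degree0 p n. \<forall>k. k \<notin> I \<longrightarrow> 0 \<le> \<alpha> k} \<subseteq> {\<alpha> \<in> degree0 p n. \<forall>k. k \<notin> J \<longrightarrow> 0 \<le> \<alpha> k}"
    using assms(2) by blast
  ultimately show ?thesis
    unfolding series_on_def by blast
qed

end

theory Submission
  imports Defs
begin

text \<open>
  The Cech complex splits over the exponent vectors: \<open>X^\<alpha>\<close> occurs in the sections over the
  intersection of the \<open>U k\<close>, \<open>k \<in> I\<close>, iff \<open>I\<close> contains every \<open>k\<close> with \<open>\<alpha> k < 0\<close>.  As \<open>\<alpha>\<close> has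
  degree \<open>0\<close>, some exponent \<open>\<alpha> j\<close> with \<open>j \<le> n\<close> is nonnegative, and the \<open>\<alpha>\<close>-part of the complex is
  contracted in positive degrees by the cone with apex \<open>j\<close>.  Only finitely many apices occur, so
  the contraction preserves the convergence of series.
\<close>

section \<open>Signs of positions\<close>

text \<open>The exponent of the sign in \<open>cech_diff\<close>. It is also used for
  \<open>j\<close> outside \<open>J\<close>, where it is the position that \<open>j\<close> takes
  once it is inserted.\<close>

definition pos :: "nat set \<Rightarrow> nat \<Rightarrow> nat" where
  "pos J j = card {k \<in> J. k < j}"

lemma pos_insert:
  assumes "finite J" "j \<notin> J"
  shows "pos (insert j J) k = pos J k + (if j < k then 1 else 0)"
proof -
  have "{l \<in> insert j J. l < k} = (if j < k then insert j {l \<in> J. l < k} else {l \<in> J. l < k})"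
    by auto
  then show ?thesis
    using assms by (simp add: pos_def)
qed

lemma pos_remove:
  assumes "finite J" "j \<in> J"
  shows "pos J k = pos (J - {j}) k + (if j < k then 1 else 0)"
  using pos_insert[of "J - {j}" j k] assms by (simp add: insert_absorb)

text \<open>Deleting the smaller of the two indices lowers the position of the larger by one, while
  deleting the larger leaves the position of the smaller unchanged. The two products therefore
  differ by one factor -1.\<close>

lemma pos_sign_swap:
  assumes "finite J" "j \<in> J" "k \<in> J" "j \<noteq> k"
  shows "(-1) ^ pos J j * (-1) ^ pos (J - {j}) k
       = - ((-1) ^ pos J k * (-1) ^ pos (J - {k}) j :: 'a::comm_ring_1)"
  using pos_remove[OF assms(1,2), of k] pos_remove[OF assms(1,3), of j] assms(4)
  by (cases j k rule: linorder_cases) (auto simp: mult.commute)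

text \<open>Pairing \<open>(j, k)\<close> with \<open>(k, j)\<close> rather than doubling the sum covers characteristic \<open>2\<close>.\<close>

lemma sum_antisym_eq_0:
  fixes f :: "'b::linorder \<Rightarrow> 'b \<Rightarrow> 'a::ab_group_add"
  assumes "finite J" and anti: "\<And>j k. j \<in> J \<Longrightarrow> k \<in> J \<Longrightarrow> j \<noteq> k \<Longrightarrow> f j k = - f k j"
  shows "(\<Sum>j\<in>J. \<Sum>k\<in>J - {j}. f j k) = 0"
proof -
  define A where "A = {(j, k). j \<in> J \<and> k \<in> J \<and> j < k}"
  define B where "B = {(j, k). j \<in> J \<and> k \<in> J \<and> k < j}"
  have fin: "finite A" "finite B"
    by (rule finite_subset[of _ "J \<times> J"]; use assms in \<open>auto simp: A_def B_def\<close>)+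
  have "(\<Sum>j\<in>J. \<Sum>k\<in>J - {j}. f j k) = (\<Sum>(j, k)\<in>(SIGMA j:J. J - {j}). f j k)"
    using assms by (intro sum.Sigma) auto
  also have "(SIGMA j:J. J - {j}) = A \<union> B"
    by (auto simp: A_def B_def)
  also have "(\<Sum>(j, k)\<in>A \<union> B. f j k) = (\<Sum>(j, k)\<in>A. f j k) + (\<Sum>(j, k)\<in>B. f j k)"
    using fin by (intro sum.union_disjoint) (auto simp: A_def B_def)
  also have "(\<Sum>(j, k)\<in>B. f j k) = (\<Sum>(j, k)\<in>A. f k j)"
    by (rule sum.reindex_bij_witness[of _ prod.swap prod.swap]) (auto simp: A_def B_def)
  also have "\<dots> = (\<Sum>(j, k)\<in>A. - f j k)"
    by (intro sum.cong) (auto simp: A_def intro: anti)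
  finally show ?thesis
    by (simp add: case_prod_unfold sum_negf)
qed

section \<open>The Cech complex\<close>

lemma cech_indexD:
  assumes "I \<in> cech_index n q"
  shows "I \<subseteq> {..n}" "card I = Suc q" "finite I" "I \<noteq> {}"
  using assms by (auto simp: cech_index_def finite_subset)

lemma cech_index_remove:
  assumes "J \<in> cech_index n (Suc q)" "j \<in> J"
  shows "J - {j} \<in> cech_index n q"
  using assms cech_indexD[OF assms(1)] by (auto simp: cech_index_def)

lemma cech_index_insert:
  assumes "I \<in> cech_index n q" "j \<le> n" "j \<notin> I"
  shows "insert j I \<in> cech_index n (Suc q)"
  using assms cech_indexD[OF assms(1)] by (auto simp: cech_index_def)

lemma cech_diff_apply:
  "J \<in> cech_index n (Suc q) \<Longrightarrow>
    cech_diff n q c J \<alpha> = (\<Sum>j\<in>J. (-1) ^ pos J j * c (J - {j}) \<alpha>)"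
  by (simp add: cech_diff_def pos_def)

lemma cech_diff_outside:
  "J \<notin> cech_index n (Suc q) \<Longrightarrow> cech_diff n q c J \<alpha> = 0"
  by (simp add: cech_diff_def)

text \<open>Deleting \<open>j\<close> and then \<open>k\<close> leaves the same face as deleting
  \<open>k\<close> and then \<open>j\<close>, with opposite sign, so the terms of the double sum
  cancel in pairs.\<close>

lemma cech_diff_diff: "cech_diff n (Suc q) (cech_diff n q c) J \<alpha> = 0"
proof (cases "J \<in> cech_index n (Suc (Suc q))")
  case True
  note J = cech_indexD[OF True]
  have "cech_diff n (Suc q) (cech_diff n q c) J \<alpha> =
    (\<Sum>j\<in>J. \<Sum>k\<in>J - {j}. (-1) ^ pos J j * (-1) ^ pos (J - {j}) k * c (J - {j} - {k}) \<alpha>)"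
    using cech_index_remove[OF True]
    by (simp add: cech_diff_apply True sum_distrib_left mult.assoc)
  also have "\<dots> = 0"
  proof (rule sum_antisym_eq_0)
    fix j k assume jk: "j \<in> J" "k \<in> J" "j \<noteq> k"
    have "J - {j} - {k} = J - {k} - {j}"
      by auto
    then show "(-1) ^ pos J j * (-1) ^ pos (J - {j}) k * c (J - {j} - {k}) \<alpha> =
      - ((-1) ^ pos J k * (-1) ^ pos (J - {k}) j * c (J - {k} - {j}) \<alpha>)"
      using pos_sign_swap[OF J(3) jk, where ?'a = 'a] by simp
  qed (use J in auto)
  finally show ?thesis .
qed (simp add: cech_diff_outside)

lemma carrier_cech_group:
  "c \<in> carrier (cech_group p v n q) \<longleftrightarrow>
    (\<forall>I \<in> cech_index n q. c I \<in> proj_sections p v n I) \<and>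
    (\<forall>I. I \<notin> cech_index n q \<longrightarrow> c I = (\<lambda>\<alpha>. 0))"
  by (auto simp: cech_group_def)

lemma cech_group_simps:
  "c \<otimes>\<^bsub>cech_group p v n q\<^esub> d = (\<lambda>I \<alpha>. c I \<alpha> + d I \<alpha>)"
  "\<one>\<^bsub>cech_group p v n q\<^esub> = (\<lambda>I \<alpha>. 0)"
  by (auto simp: cech_group_def)

lemma degree0_nonneg_exponent:
  assumes "\<alpha> \<in> degree0 p n"
  shows "\<exists>j\<le>n. 0 \<le> \<alpha> j"
proof (rule ccontr)
  assume "\<not> (\<exists>j\<le>n. 0 \<le> \<alpha> j)"
  then have "(\<Sum>k\<le>n. \<alpha> k) < (\<Sum>k\<le>n. 0)"
    by (intro sum_strict_mono) (simp_all, meson not_le)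
  then show False
    using assms by (simp add: degree0_def)
qed

text \<open>The choice depends on \<alpha> alone and not on an index set, so that all faces of a
  simplex are coned off from the same vertex.\<close>

definition apex :: "nat \<Rightarrow> exponent \<Rightarrow> nat" where
  "apex n \<alpha> = (SOME j. j \<le> n \<and> 0 \<le> \<alpha> j)"

lemma apex:
  assumes "\<alpha> \<in> degree0 p n"
  shows "apex n \<alpha> \<le> n" "0 \<le> \<alpha> (apex n \<alpha>)"
  using someI_ex[OF degree0_nonneg_exponent[OF assms]]
  by (auto simp: apex_def)

section \<open>Convergent series and the groups of cochains\<close>

context perfectoid_field
begin

lemma series_zero: "(\<lambda>\<alpha>. 0) \<in> series_on v M"
  by (auto simp: series_on_def)

lemma series_uminus: "a \<in> series_on v M \<Longrightarrow> (\<lambda>\<alpha>. - a \<alpha>) \<in> series_on v M"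
  by (auto simp: series_on_def v_minus)

lemma series_add:
  assumes "a \<in> series_on v M" "b \<in> series_on v M"
  shows "(\<lambda>\<alpha>. a \<alpha> + b \<alpha>) \<in> series_on v M"
  using series_diff[OF assms(1) series_uminus[OF assms(2)]] by simp

lemma series_sum:
  assumes "\<And>j. j \<in> J \<Longrightarrow> a j \<in> series_on v M"
  shows "(\<lambda>\<alpha>. \<Sum>j\<in>J. a j \<alpha>) \<in> series_on v M"
  using assms by (induction J rule: infinite_finite_induct) (auto intro: series_zero series_add)

lemma series_sign:
  assumes "a \<in> series_on v M"
  shows "(\<lambda>\<alpha>. (-1) ^ m * a \<alpha>) \<in> series_on v M"
  using assms series_uminus[OF assms] by (cases "even m") auto

lemma proj_sections_index:
  assumes "I \<in> cech_index n q"
  shows "proj_sections p v n I =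
    series_on v {\<alpha> \<in> degree0 p n. \<forall>k. k \<notin> I \<longrightarrow> 0 \<le> \<alpha> k}"
  using cech_indexD[OF assms] by (intro proj_sections_eq)

lemma cech_comm_group: "comm_group (cech_group p v n q)"
proof (rule comm_groupI)
  fix c assume c: "c \<in> carrier (cech_group p v n q)"
  then have "(\<lambda>I \<alpha>. - c I \<alpha>) \<in> carrier (cech_group p v n q)"
    by (auto simp: carrier_cech_group proj_sections_index intro: series_uminus)
  then show "\<exists>d\<in>carrier (cech_group p v n q).
      d \<otimes>\<^bsub>cech_group p v n q\<^esub> c = \<one>\<^bsub>cech_group p v n q\<^esub>"
    by (rule rev_bexI) (simp add: cech_group_simps)
qed (auto simp: carrier_cech_group cech_group_simps proj_sections_index add_ac
    intro: series_zero series_add)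

text \<open>Restriction maps are inclusions, so the components on all faces of \<open>J\<close>
  already lie in the sections over \<open>J\<close>, where a finite signed sum stays
  convergent.\<close>

lemma cech_diff_carrier:
  assumes c: "c \<in> carrier (cech_group p v n q)"
  shows "cech_diff n q c \<in> carrier (cech_group p v n (Suc q))"
  unfolding carrier_cech_group
proof (intro conjI ballI allI impI)
  fix J assume J: "J \<in> cech_index n (Suc q)"
  have "c (J - {j}) \<in> proj_sections p v n J" if "j \<in> J" for j
  proof -
    note idx = cech_index_remove[OF J that]
    have "proj_sections p v n (J - {j}) \<subseteq> proj_sections p v n J"
      using cech_indexD(4)[OF idx] cech_indexD(1)[OF J] by (intro proj_sections_mono) auto
    then show ?thesis
      using c idx by (auto simp: carrier_cech_group)
  qed
  then have "(\<lambda>\<alpha>. \<Sum>j\<in>J. (-1) ^ pos J j * c (J - {j}) \<alpha>) \<in> proj_sections p v n J"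
    unfolding proj_sections_index[OF J] by (intro series_sum series_sign) auto
  moreover have "cech_diff n q c J = (\<lambda>\<alpha>. \<Sum>j\<in>J. (-1) ^ pos J j * c (J - {j}) \<alpha>)"
    using J by (simp add: fun_eq_iff cech_diff_apply)
  ultimately show "cech_diff n q c J \<in> proj_sections p v n J"
    by simp
qed (simp add: fun_eq_iff cech_diff_outside)

lemma cech_diff_hom:
  "group_hom (cech_group p v n q) (cech_group p v n (Suc q)) (cech_diff n q)"
proof -
  have "cech_diff n q \<in> hom (cech_group p v n q) (cech_group p v n (Suc q))"
  proof (rule homI)
    fix c d
    show "cech_diff n q (c \<otimes>\<^bsub>cech_group p v n q\<^esub> d) =
      cech_diff n q c \<otimes>\<^bsub>cech_group p v n (Suc q)\<^esub> cech_diff n q d"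
      by (simp add: cech_group_simps cech_diff_def fun_eq_iff distrib_left sum.distrib)
  qed (rule cech_diff_carrier)
  then show ?thesis
    by (intro group_hom.intro group_hom_axioms.intro comm_group.axioms cech_comm_group)
qed

lemma cech_cocycles_iff:
  "c \<in> cech_cocycles p v n q \<longleftrightarrow>
    c \<in> carrier (cech_group p v n q) \<and> (\<forall>J \<alpha>. cech_diff n q c J \<alpha> = 0)"
  by (simp add: cech_cocycles_def kernel_def cech_group_simps fun_eq_iff)

section \<open>The contraction\<close>

text \<open>The cone operator, applied to each exponent vector with its own apex. It is 0 when the
  apex already lies in \<open>I\<close>, since the cone is then degenerate. Outside
  \<open>degree0\<close> the choice of apex carries no information, hence the default 0.\<close>

definition contraction :: "nat \<Rightarrow> nat \<Rightarrow> (nat set \<Rightarrow> 'k series) \<Rightarrow> nat set \<Rightarrow> 'k series" where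
  "contraction n q c = (\<lambda>I \<alpha>.
     if I \<in> cech_index n q \<and> \<alpha> \<in> degree0 p n \<and> apex n \<alpha> \<notin> I
     then (-1) ^ pos I (apex n \<alpha>) * c (insert (apex n \<alpha>) I) \<alpha> else 0)"

text \<open>The component at \<open>I\<close> is patched together from the series
  \<open>c (insert j I)\<close>. These allow a negative exponent at \<open>j\<close> as well, but
  the coefficient of \<alpha> is taken from \<open>c (insert j I)\<close> only when \<open>j\<close>
  is the apex of \<alpha>, where the exponent is nonnegative.\<close>

lemma contraction_carrier:
  assumes c: "c \<in> carrier (cech_group p v n (Suc q))"
  shows "contraction n q c \<in> carrier (cech_group p v n q)"
  unfolding carrier_cech_group
proof (intro conjI ballI allI impI)
  fix I assume I: "I \<in> cech_index n q"
  have sec: "c (insert j I) \<in> series_on v {\<alpha> \<in> degree0 p n. \<forall>k. k \<notin> insert j I \<longrightarrow> 0 \<le> \<alpha> k}"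
    if "j \<le> n" "j \<notin> I" for j
    using c cech_index_insert[OF I that] proj_sections_index[OF cech_index_insert[OF I that]]
    by (auto simp: carrier_cech_group)
  have "finite {\<alpha>. v (contraction n q c I \<alpha>) > \<epsilon>}" if \<epsilon>: "\<epsilon> > 0" for \<epsilon>
  proof (rule finite_subset)
    have vsign: "v ((-1) ^ m * x) = v x" for m x
      by (cases "even m") (auto simp: v_minus)
    \<comment> \<open>The apex varies with \<alpha> but takes at most n + 1 values. Signs do not
      change \<open>v\<close>, so the large coefficients lie in a finite union of finite
      sets.\<close>
    show "{\<alpha>. v (contraction n q c I \<alpha>) > \<epsilon>} \<subseteq> (\<Union>j\<in>{..n} - I. {\<alpha>. v (c (insert j I) \<alpha>) > \<epsilon>})"
      using \<epsilon> apex(1) by (auto simp: contraction_def vsign split: if_splits)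
    show "finite (\<Union>j\<in>{..n} - I. {\<alpha>. v (c (insert j I) \<alpha>) > \<epsilon>})"
      using sec \<epsilon> by (auto simp: series_on_def)
  qed
  moreover have "\<alpha> \<in> degree0 p n \<and> (\<forall>k. k \<notin> I \<longrightarrow> 0 \<le> \<alpha> k)"
    if nz: "contraction n q c I \<alpha> \<noteq> 0" for \<alpha>
  proof -
    let ?j = "apex n \<alpha>"
    have j: "\<alpha> \<in> degree0 p n" "?j \<notin> I" "c (insert ?j I) \<alpha> \<noteq> 0"
      using nz by (auto simp: contraction_def split: if_splits)
    have "\<forall>k. k \<notin> insert ?j I \<longrightarrow> 0 \<le> \<alpha> k"
      using sec[OF apex(1)[OF j(1)] j(2)] j(3) unfolding series_on_def by blast
    then show ?thesis
      using j(1) apex(2)[OF j(1)] by (metis insertE)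
  qed
  ultimately show "contraction n q c I \<in> proj_sections p v n I"
    unfolding proj_sections_index[OF I] series_on_def by blast
qed (simp add: contraction_def fun_eq_iff)

text \<open>With d the differential and h the contraction, this is the homotopy identity dh + hd =
  id in each degree 0 exponent vector, evaluated on a cocycle, where hd vanishes.\<close>

lemma cech_diff_contraction:
  assumes c: "c \<in> cech_cocycles p v n (Suc q)"
  shows "cech_diff n q (contraction n q c) = c"
proof (intro ext)
  fix J \<alpha>
  have car: "c \<in> carrier (cech_group p v n (Suc q))"
    and closed: "cech_diff n (Suc q) c L \<alpha> = 0" for L
    using c by (auto simp: cech_cocycles_iff)
  consider "J \<notin> cech_index n (Suc q)" | "J \<in> cech_index n (Suc q)" "\<alpha> \<notin> degree0 p n"
    | "J \<in> cech_index n (Suc q)" "\<alpha> \<in> degree0 p n"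
    by blast
  then show "cech_diff n q (contraction n q c) J \<alpha> = c J \<alpha>"
  proof cases
    case 1
    then show ?thesis
      using car by (simp add: cech_diff_outside carrier_cech_group)
  next
    \<comment> \<open>Both sides are 0: sections have no coefficients outside degree 0, and the
      contraction is 0 there by default.\<close>
    case 2
    then have "c J \<alpha> = 0"
      using car proj_sections_index[OF 2(1)] by (auto simp: carrier_cech_group series_on_def)
    then show ?thesis
      using 2 by (simp add: cech_diff_apply contraction_def)
  next
    case 3
    note J = cech_indexD[OF 3(1)]
    define j where "j = apex n \<alpha>"
    have "j \<le> n"
      using 3 by (simp add: j_def apex)
    have h: "contraction n q c (J - {k}) \<alpha> =
      (if j \<in> J - {k} then 0 else (-1) ^ pos (J - {k}) j * c (insert j (J - {k})) \<alpha>)"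
      if "k \<in> J" for k
      using that cech_index_remove[OF 3(1)] 3(2) by (simp add: contraction_def j_def)
    have diff: "cech_diff n q (contraction n q c) J \<alpha> = (\<Sum>k\<in>J. (-1) ^ pos J k *
      (if j \<in> J - {k} then 0 else (-1) ^ pos (J - {k}) j * c (insert j (J - {k})) \<alpha>))"
      using 3(1) by (simp add: cech_diff_apply h cong: sum.cong)
    show ?thesis
    proof (cases "j \<in> J")
      case True
      \<comment> \<open>Every face of \<open>J\<close> other than \<open>J - {j}\<close> still
        contains the apex and contributes 0. The remaining term carries the same sign twice, as
        removing \<open>j\<close> does not change its own position.\<close>
      have "cech_diff n q (contraction n q c) J \<alpha> =
        (\<Sum>k\<in>J. if k = j then (-1) ^ pos J j * ((-1) ^ pos (J - {j}) j * c J \<alpha>) else 0)"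
        unfolding diff using True by (intro sum.cong) (auto simp: insert_absorb)
      also have "\<dots> = (-1) ^ pos J j * ((-1) ^ pos (J - {j}) j * c J \<alpha>)"
        using True J(3) by simp
      also have "\<dots> = c J \<alpha>"
        using pos_remove[OF J(3) True, of j]
        by (simp add: mult.assoc[symmetric] power_mult_distrib[symmetric])
      finally show ?thesis .
    next
      case False
      \<comment> \<open>Here the cocycle condition enters, on the simplex \<open>L\<close> spanned
        by \<open>J\<close> and the apex. Its face opposite \<open>j\<close> is \<open>J\<close>,
        and its other faces are the cones over the faces of \<open>J\<close>.\<close>
      define L where "L = insert j J"
      have L: "L \<in> cech_index n (Suc (Suc q))" "finite L" "j \<in> L" "L - {j} = J"
        using cech_index_insert[OF 3(1) \<open>j \<le> n\<close> False] J False by (auto simp: L_def)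
      have swap: "(-1) ^ pos L j * ((-1) ^ pos J k * ((-1) ^ pos (J - {k}) j * x)) =
        - ((-1) ^ pos L k * x)" if "k \<in> J" for k and x :: 'k
      proof -
        have k: "k \<in> L" "k \<noteq> j"
          using that False by (auto simp: L_def)
        \<comment> \<open>The two sets differ only in \<open>j\<close>, which is not counted in its
          own position. The resulting sign occurs squared below and cancels.\<close>
        have "pos (J - {k}) j = pos (L - {k}) j"
          unfolding pos_def by (rule arg_cong[of _ _ card]) (auto simp: L_def)
        then have "(-1) ^ pos L j * (-1) ^ pos J k * (-1) ^ pos (J - {k}) j =
          - ((-1) ^ pos L k * ((-1) ^ pos (L - {k}) j * (-1) ^ pos (L - {k}) j) :: 'k)"
          using pos_sign_swap[OF L(2,3) k(1) k(2)[symmetric], where ?'a = 'k] L(4) by simp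
        then show ?thesis
          by (simp add: mult.assoc[symmetric] power_mult_distrib[symmetric])
      qed
      have "0 = (\<Sum>k\<in>L. (-1) ^ pos L k * c (L - {k}) \<alpha>)"
        using closed[of L] L(1) by (simp add: cech_diff_apply)
      also have "\<dots> = (-1) ^ pos L j * c J \<alpha> + (\<Sum>k\<in>J. (-1) ^ pos L k * c (L - {k}) \<alpha>)"
        using J(3) False L(4) by (simp add: L_def)
      also have "(\<Sum>k\<in>J. (-1) ^ pos L k * c (L - {k}) \<alpha>) =
        (\<Sum>k\<in>J. - ((-1) ^ pos L j *
          ((-1) ^ pos J k * ((-1) ^ pos (J - {k}) j * c (insert j (J - {k})) \<alpha>))))"
      proof (rule sum.cong)
        fix k assume "k \<in> J"
        then have "insert j (J - {k}) = L - {k}"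
          using False by (auto simp: L_def)
        then show "(-1) ^ pos L k * c (L - {k}) \<alpha> = - ((-1) ^ pos L j *
          ((-1) ^ pos J k * ((-1) ^ pos (J - {k}) j * c (insert j (J - {k})) \<alpha>)))"
          using swap[OF \<open>k \<in> J\<close>] by simp
      qed simp
      \<comment> \<open>The cocycle condition now reads 0 = s (c - dhc) at \<open>J\<close> and
        \<alpha> with a sign s, which can be cancelled.\<close>
      also have "\<dots> = - ((-1) ^ pos L j * cech_diff n q (contraction n q c) J \<alpha>)"
        unfolding diff using False by (simp add: sum_negf sum_distrib_left)
      finally show ?thesis
        by simp
    qed
  qed
qed

text \<open>One inclusion is dd = 0. For the other, the contraction of a cocycle is a cochain whose
  differential is that cocycle.\<close>

lemma cech_coboundaries_eq_cocycles:
  "cech_coboundaries p v n (Suc q) = cech_cocycles p v n (Suc q)"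
proof (intro equalityI subsetI)
  fix c assume "c \<in> cech_coboundaries p v n (Suc q)"
  then show "c \<in> cech_cocycles p v n (Suc q)"
    by (auto simp: cech_cocycles_iff cech_diff_diff cech_diff_carrier)
next
  fix c assume c: "c \<in> cech_cocycles p v n (Suc q)"
  then have "contraction n q c \<in> carrier (cech_group p v n q)"
    by (intro contraction_carrier) (simp add: cech_cocycles_iff)
  then show "c \<in> cech_coboundaries p v n (Suc q)"
    using cech_diff_contraction[OF c] by (auto intro: rev_image_eqI)
qed

end

section \<open>Triviality of the cohomology group\<close>

lemma (in group) trivial_group_Mod_carrier: "trivial_group (G Mod carrier G)"
proof -
  have coset: "carrier G #> x = carrier G" "x <# carrier G = carrier G" if "x \<in> carrier G" for x
    using that subgroup_self by (simp_all add: coset_join2 coset_join3)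
  then have "carrier G \<lhd> G"
    by (intro normalI subgroup_self) simp
  then have "group (G Mod carrier G)"
    by (rule normal.factorgroup_is_group)
  moreover have "carrier (G Mod carrier G) = {carrier G}"
    using coset(1) by (auto simp: FactGroup_def RCOSETS_def)
  ultimately show ?thesis
    by (simp add: trivial_group_def FactGroup_def)
qed

theorem theorem5p2:
  fixes p n i :: nat and v :: "'k::field \<Rightarrow> real"
  assumes "perfectoid_field p v"
    and "n > 0"
    and "0 < i" and "i < n"
  shows "trivial_group (proj_cohomology p v n i)"
proof -
  interpret perfectoid_field p v
    by (rule assms)
  \<comment> \<open>In positive degree the coboundaries are the image of the differential from
    degree \<open>q\<close>, and the contraction has a target.\<close>
  obtain q where i: "i = Suc q"
    using assms by (cases i) auto
  let ?Z = "(cech_group p v n i)\<lparr>carrier := cech_cocycles p v n i\<rparr>"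
  have "subgroup (cech_cocycles p v n i) (cech_group p v n i)"
    unfolding cech_cocycles_def by (rule group_hom.subgroup_kernel[OF cech_diff_hom])
  then have "group ?Z"
    by (intro subgroup.subgroup_is_group comm_group.axioms cech_comm_group)
  then have "trivial_group (?Z Mod carrier ?Z)"
    by (rule group.trivial_group_Mod_carrier)
  then show ?thesis
    by (simp add: proj_cohomology_def i cech_coboundaries_eq_cocycles del: cech_coboundaries.simps)
qed

end
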